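(* Let $\Omega\subset\mathbb{R}^n$ be open and $(K,\delta)$-quasi-convex, where $K\ge1$ and $\delta>0$, and suppose that $\varphi\in\Phi_{\mathrm w}(\Omega)$ satisfies (A0) and (aDec)$_q$ with $q\ge1$. If $\varphi$ satisfies (A1), then $\varphi$ satisfies (A1)$_\Omega$.
   Context: $L^0(\Omega)$ is the set of measurable functions on $\Omega$; $|B|$ is Lebesgue measure. **Almost monotone.** For $A\subset\mathbb{R}$, $f:A\to[-\infty,\infty]$ is $L$-almost increasing if $f(s)\le Lf(t)$ whenever $s<t$, and $L$-almost decreasing if $f(t)\le Lf(s)$ whenever $s<t$. **Weak $\Phi$-functions.** $\varphi:\Omega\times[0,\infty)\to[0,\infty]$ is a weak $\Phi$-function, $\varphi\in\Phi_{\mathrm w}(\Omega)$, if: (i) for every $x\in\Omega$, $t\mapsto\varphi(x,t)$ is non-decreasing, $\lim_{t\to0^+}\varphi(x,t)=0=\varphi(x,0)$ and $\lim_{t\to\infty}\varphi(x,t)=\infty$; (ii) there is $L\ge1$ such that $t\mapsto\varphi(x,t)/t$ is $L$-almost increasing on $(0,\infty)$ for every $x\in\Omega$; (iii) for every $f\in L^0(\Omega)$, $x\mapsto\varphi(x,|f(x)|)$ is measurable. The left-inverse is $\varphi^{-1}(x,\tau):=\inf\{t\ge0:\varphi(x,t)\ge\tau\}$. **Conditions** on $\varphi\in\Phi_{\mathrm w}(\Omega)$: - (A0): there is $\beta\in(0,1)$ with $\beta\le\varphi^{-1}(x,1)\le\beta^{-1}$ for every $x\in\Omega$. - (A1): there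 is $\beta\in(0,1)$ with $\beta\varphi^{-1}(x,t)\le\varphi^{-1}(y,t)$ whenever $t\in[1,1/|B|]$, for every ball $B$ with $|B|\le1$ and every $x,y\in B\cap\Omega$. - (A1)$_\Omega$: there is $\beta\in(0,1)$ with $\beta^{|x-y|t^{1/n}+1}\varphi^{-1}(x,t)\le\varphi^{-1}(y,t)$ for every $x,y\in\Omega$ and every $t\ge1$. - (aDec)$_q$: there is $L_q\ge1$ such that $t\mapsto\varphi(x,t)/t^q$ is $L_q$-almost decreasing in $(0,\infty)$ for every $x\in\Omega$. **$(K,\delta)$-quasi-convex.** $\Omega$ is $(K,\delta)$-quasi-convex if whenever $x,y\in\Omega$ satisfy $|x-y|<\delta$, there exists a rectifiable curve $\gamma$ lying in $\Omega$ and connecting $x$ and $y$ such that its length satisfies $\ell(\gamma)\le K|x-y|$. *)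

theory Defs
  imports "HOL-Analysis.Analysis"
begin

text \<open>
  A function \<open>\<phi> : \<Omega> \<times> [0,\<infinity>) \<rightarrow> [0,\<infinity>]\<close> is represented by
  \<^term>\<open>\<phi> :: 'a \<Rightarrow> real \<Rightarrow> ennreal\<close>; its values outside \<open>\<Omega> \<times> [0,\<infinity>)\<close> are never used.
  The Euclidean space \<^typ>\<open>'a\<close> has dimension \<open>n = DIM('a) \<ge> 1\<close>.
  Almost monotonicity is only needed for functions with values in \<open>[0,\<infinity>]\<close>.
\<close>

definition almost_increasing_on :: "real set \<Rightarrow> real \<Rightarrow> (real \<Rightarrow> ennreal) \<Rightarrow> bool" where
  "almost_increasing_on A L f \<longleftrightarrow> (\<forall>s\<in>A. \<forall>t\<in>A. s < t \<longrightarrow> f s \<le> ennreal L * f t)"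

definition almost_decreasing_on :: "real set \<Rightarrow> real \<Rightarrow> (real \<Rightarrow> ennreal) \<Rightarrow> bool" where
  "almost_decreasing_on A L f \<longleftrightarrow> (\<forall>s\<in>A. \<forall>t\<in>A. s < t \<longrightarrow> f t \<le> ennreal L * f s)"

definition weak_Phi :: "'a::euclidean_space set \<Rightarrow> ('a \<Rightarrow> real \<Rightarrow> ennreal) \<Rightarrow> bool" where
  "weak_Phi \<Omega> \<phi> \<longleftrightarrow>
     (\<forall>x\<in>\<Omega>. mono_on {0..} (\<phi> x) \<and> \<phi> x 0 = 0 \<and>
             (\<phi> x \<longlongrightarrow> 0) (at_right 0) \<and> (\<phi> x \<longlongrightarrow> \<infinity>) at_top) \<and>
     (\<exists>L\<ge>1. \<forall>x\<in>\<Omega>. almost_increasing_on {0<..} L (\<lambda>t. \<phi> x t / ennreal t)) \<and>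
     (\<forall>f::'a \<Rightarrow> real. f \<in> borel_measurable (lebesgue_on \<Omega>) \<longrightarrow>
        (\<lambda>x. \<phi> x \<bar>f x\<bar>) \<in> borel_measurable (lebesgue_on \<Omega>))"

text \<open>
  For real \<open>\<tau>\<close> and a weak \<open>\<Phi>\<close>-function \<open>\<phi>\<close> the set below is nonempty, because
  \<open>\<phi>(x,t) \<rightarrow> \<infinity>\<close> as \<open>t \<rightarrow> \<infinity>\<close>, and it is bounded below by 0; so the real-valued infimum is
  the true one.
\<close>

definition left_inverse :: "('a \<Rightarrow> real \<Rightarrow> ennreal) \<Rightarrow> 'a \<Rightarrow> real \<Rightarrow> real" where
  "left_inverse \<phi> x \<tau> = Inf {t. 0 \<le> t \<and> ennreal \<tau> \<le> \<phi> x t}"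

definition A0 :: "'a::euclidean_space set \<Rightarrow> ('a \<Rightarrow> real \<Rightarrow> ennreal) \<Rightarrow> bool" where
  "A0 \<Omega> \<phi> \<longleftrightarrow> (\<exists>\<beta>\<in>{0<..<1}. \<forall>x\<in>\<Omega>.
     \<beta> \<le> left_inverse \<phi> x 1 \<and> left_inverse \<phi> x 1 \<le> inverse \<beta>)"

definition A1 :: "'a::euclidean_space set \<Rightarrow> ('a \<Rightarrow> real \<Rightarrow> ennreal) \<Rightarrow> bool" where
  "A1 \<Omega> \<phi> \<longleftrightarrow> (\<exists>\<beta>\<in>{0<..<1}. \<forall>z r. 0 < r \<and> measure lebesgue (ball z r) \<le> 1 \<longrightarrow>
     (\<forall>x\<in>ball z r \<inter> \<Omega>. \<forall>y\<in>ball z r \<inter> \<Omega>. \<forall>t\<in>{1..1 / measure lebesgue (ball z r)}.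
        \<beta> * left_inverse \<phi> x t \<le> left_inverse \<phi> y t))"

definition A1_Omega :: "'a::euclidean_space set \<Rightarrow> ('a \<Rightarrow> real \<Rightarrow> ennreal) \<Rightarrow> bool" where
  "A1_Omega \<Omega> \<phi> \<longleftrightarrow> (\<exists>\<beta>\<in>{0<..<1}. \<forall>x\<in>\<Omega>. \<forall>y\<in>\<Omega>. \<forall>t\<ge>1.
     \<beta> powr (norm (x - y) * t powr (1 / real DIM('a)) + 1) * left_inverse \<phi> x t
       \<le> left_inverse \<phi> y t)"

definition aDec :: "'a::euclidean_space set \<Rightarrow> real \<Rightarrow> ('a \<Rightarrow> real \<Rightarrow> ennreal) \<Rightarrow> bool" where
  "aDec \<Omega> q \<phi> \<longleftrightarrow>
     (\<exists>L\<ge>1. \<forall>x\<in>\<Omega>. almost_decreasing_on {0<..} L (\<lambda>t. \<phi> x t / ennreal (t powr q)))"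

text \<open>
  The length of a curve \<open>g : [0,1] \<rightarrow> \<real>\<^sup>n\<close>: the supremum of the lengths of the inscribed
  polygons with vertices \<open>g (p 0), \<dots>, g (p N)\<close>, where \<open>0 = p 0 \<le> \<dots> \<le> p N = 1\<close>.
\<close>

definition curve_length :: "(real \<Rightarrow> 'a::real_normed_vector) \<Rightarrow> ennreal" where
  "curve_length g =
     (SUP (N, p) \<in> {(N::nat, p::nat \<Rightarrow> real). p 0 = 0 \<and> p N = 1 \<and> mono_on {..N} p}.
        ennreal (\<Sum>i<N. norm (g (p (Suc i)) - g (p i))))"

definition rectifiable :: "(real \<Rightarrow> 'a::real_normed_vector) \<Rightarrow> bool" where
  "rectifiable g \<longleftrightarrow> path g \<and> curve_length g < \<infinity>"

definition quasi_convex :: "real \<Rightarrow> real \<Rightarrow> 'a::euclidean_space set \<Rightarrow> bool" where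
  "quasi_convex K \<delta> \<Omega> \<longleftrightarrow> (\<forall>x\<in>\<Omega>. \<forall>y\<in>\<Omega>. norm (x - y) < \<delta> \<longrightarrow>
     (\<exists>g. rectifiable g \<and> path_image g \<subseteq> \<Omega> \<and> pathstart g = x \<and> pathfinish g = y \<and>
          curve_length g \<le> ennreal (K * norm (x - y))))"

end

theory Submission
  imports Defs
begin

text \<open>
  Write \<open>f x = left_inverse \<phi> x t\<close> for a fixed level \<open>t \<ge> 1\<close>, and let \<open>r\<close> be the radius for which
  a ball has measure exactly \<open>1 / t\<close>.  Then \<open>r\<close> is comparable to \<open>t\<close> to the power \<open>-1/n\<close>, so the
  exponent in \<^const>\<open>A1_Omega\<close> counts how many steps of size \<open>r\<close> separate \<open>x\<close> from \<open>y\<close>, and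
  \<^const>\<open>A1\<close> says that one step inside \<open>\<Omega>\<close> costs at most a factor \<open>\<beta>\<close> (lemma \<open>A1_step\<close>).

  If \<open>x\<close> and \<open>y\<close> are closer than \<open>\<delta>\<close>, they are joined by a curve in \<open>\<Omega>\<close> of length
  \<open>\<le> K |x - y|\<close>.  Such a curve can be traversed in at most \<open>2 K |x - y| / r + 1\<close> steps, and the
  factors multiply (lemmas \<open>Harnack_chain\<close> and \<open>Harnack_curve\<close>).

  If \<open>|x - y| \<ge> \<delta>\<close> there need not be any curve, but then the claimed factor is exponentially
  small in \<open>t\<close> to the power \<open>1/n\<close>.  On the other hand \<open>f y\<close> is bounded below by a constant, and
  \<open>f x\<close> grows at most linearly in \<open>t\<close> because \<open>\<phi> x\<close> grows at least linearly and is controlled at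
  level \<open>1\<close> by \<^const>\<open>A0\<close> (lemmas \<open>left_inverse_mono\<close> and \<open>left_inverse_le_linear\<close>).  The
  exponential wins (lemma \<open>exp_decay_beats_power\<close>).
\<close>

section \<open>Bounds on the left-inverse\<close>

lemma left_inverse_le:
  assumes "0 \<le> s" and "ennreal \<tau> \<le> \<phi> x s"
  shows "left_inverse \<phi> x \<tau> \<le> s"
  unfolding left_inverse_def
  by (rule cInf_lower) (use assms in \<open>auto intro!: bdd_belowI[of _ 0]\<close>)

text \<open>
  Some witness \<open>s\<close> must reach level \<open>t\<close>, because the real-valued infimum of the empty set is an
  unspecified number.
\<close>

lemma left_inverse_mono:
  assumes "\<tau> \<le> t" and "0 \<le> s" and "ennreal t \<le> \<phi> x s"
  shows "left_inverse \<phi> x \<tau> \<le> left_inverse \<phi> x t"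
  unfolding left_inverse_def
proof (rule cInf_superset_mono)
  show "{u. 0 \<le> u \<and> ennreal t \<le> \<phi> x u} \<noteq> {}"
    using assms by blast
  show "bdd_below {u. 0 \<le> u \<and> ennreal \<tau> \<le> \<phi> x u}"
    by (auto intro!: bdd_belowI[of _ 0])
  show "{u. 0 \<le> u \<and> ennreal t \<le> \<phi> x u} \<subseteq> {u. 0 \<le> u \<and> ennreal \<tau> \<le> \<phi> x u}"
    using assms(1) by (auto intro: order_trans[OF ennreal_leI])
qed

lemma le_of_left_inverse_less:
  assumes "mono_on {0..} (\<phi> x)" and "\<exists>u\<ge>0. ennreal \<tau> \<le> \<phi> x u"
    and "left_inverse \<phi> x \<tau> < s"
  shows "ennreal \<tau> \<le> \<phi> x s"
proof -
  have "{t. 0 \<le> t \<and> ennreal \<tau> \<le> \<phi> x t} \<noteq> {}"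
    using assms(2) by blast
  then obtain u where u: "0 \<le> u" "ennreal \<tau> \<le> \<phi> x u" "u < s"
    using cInf_lessD[OF _ assms(3)[unfolded left_inverse_def]] by auto
  have "\<phi> x u \<le> \<phi> x s"
    using assms(1) u by (auto intro: mono_onD)
  with u show ?thesis by order
qed

text \<open>
  Almost monotonicity of \<open>\<phi> x t / t\<close> lets one multiply the value by \<open>t\<close> at the cost of multiplying
  the argument by \<open>L * t\<close>; the extra \<open>L\<close> in the argument cancels the one in the hypothesis.
\<close>

lemma almost_increasing_scaling:
  assumes inc: "almost_increasing_on {0<..} L (\<lambda>t. \<psi> t / ennreal t)"
    and "1 \<le> L" and "1 \<le> t" and "0 < s" and "1 \<le> \<psi> s"
  shows "ennreal t \<le> \<psi> (L * t * s)"
proof (cases "L * t = 1")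
  case True
  then have "t = 1"
    using assms(2,3) mult_mono[of 1 L t t] by simp
  with True assms(5) show ?thesis by simp
next
  case False
  have "1 * 1 \<le> L * t"
    using assms(2,3) by (intro mult_mono) auto
  with False have Lt: "1 < L * t" by simp
  have pos: "0 < L * t * s" and less: "s < L * t * s"
    using Lt assms(4) by simp_all
  have "\<psi> s / ennreal s \<le> ennreal L * (\<psi> (L * t * s) / ennreal (L * t * s))"
    using inc less pos assms(4) unfolding almost_increasing_on_def by auto
  then have "1 / ennreal s \<le> ennreal L * (\<psi> (L * t * s) / ennreal (L * t * s))"
    using divide_right_mono_ennreal[OF assms(5)] by (rule order_trans[rotated])
  then have "ennreal (t * s) * (1 / ennreal s)
      \<le> ennreal (t * s) * (ennreal L * (\<psi> (L * t * s) / ennreal (L * t * s)))"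
    by (rule mult_left_mono) simp
  moreover have "ennreal (t * s) * (1 / ennreal s) = ennreal t"
    using assms(3,4) by (simp add: divide_ennreal flip: ennreal_mult ennreal_1)
  moreover have "ennreal (t * s) * (ennreal L * (\<psi> (L * t * s) / ennreal (L * t * s)))
      = \<psi> (L * t * s)"
  proof -
    have "ennreal (t * s) * (ennreal L * (\<psi> (L * t * s) / ennreal (L * t * s)))
        = (ennreal (t * s) * ennreal L) * \<psi> (L * t * s) / ennreal (L * t * s)"
      by (simp add: ennreal_times_divide mult.assoc)
    also have "ennreal (t * s) * ennreal L = ennreal (L * t * s)"
      using assms(2,3,4) by (simp add: mult_ac flip: ennreal_mult)
    also have "ennreal (L * t * s) * \<psi> (L * t * s) / ennreal (L * t * s) = \<psi> (L * t * s)"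
      using pos by (subst mult.commute, intro ennreal_mult_divide_eq) auto
    finally show ?thesis .
  qed
  ultimately show ?thesis by simp
qed

lemma weak_Phi_level_reached:
  assumes "weak_Phi \<Omega> \<phi>" and "x \<in> \<Omega>"
  shows "\<exists>s\<ge>0. ennreal \<tau> \<le> \<phi> x s"
proof -
  have "(\<phi> x \<longlongrightarrow> \<infinity>) at_top"
    using assms unfolding weak_Phi_def by blast
  then have "eventually (\<lambda>s. ennreal \<tau> < \<phi> x s) at_top"
    by (rule order_tendstoD) simp
  then have "eventually (\<lambda>s. 0 \<le> s \<and> ennreal \<tau> \<le> \<phi> x s) at_top"
    using eventually_ge_at_top[of 0] by eventually_elim auto
  then show ?thesis
    by (auto simp: eventually_at_top_linorder)
qed

text \<open>
  The factor \<open>2\<close> moves strictly above \<open>left_inverse \<phi> x 1\<close>: only there is \<open>\<phi> x s \<ge> 1\<close> guaranteed,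
  since \<open>\<phi> x\<close> may jump over level \<open>1\<close> immediately to the right of its left-inverse.
\<close>

lemma left_inverse_le_linear:
  assumes "weak_Phi \<Omega> \<phi>" and "x \<in> \<Omega>"
    and inc: "almost_increasing_on {0<..} L (\<lambda>t. \<phi> x t / ennreal t)" and "1 \<le> L"
    and "0 < b" and "left_inverse \<phi> x 1 \<le> inverse b" and "1 \<le> t"
  shows "left_inverse \<phi> x t \<le> 2 * L / b * t"
proof -
  have mono: "mono_on {0..} (\<phi> x)"
    using assms(1,2) unfolding weak_Phi_def by blast
  have "inverse b < 2 / b"
    using assms(5) by (simp add: field_simps)
  then have "ennreal 1 \<le> \<phi> x (2 / b)"
    using assms(6)
    by (intro le_of_left_inverse_less mono weak_Phi_level_reached[OF assms(1,2)]) simp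
  then have "ennreal t \<le> \<phi> x (L * t * (2 / b))"
    using assms(4,5,7) by (intro almost_increasing_scaling[OF inc]) auto
  then have "left_inverse \<phi> x t \<le> L * t * (2 / b)"
    using assms(4,5,7) by (intro left_inverse_le) auto
  then show ?thesis by (simp add: mult_ac)
qed

section \<open>Chaining along a curve\<close>

text \<open>
  The number of factors is controlled by the length of the polygon, not by its number of vertices,
  which may be huge.  While walking along the vertices one keeps an anchor \<open>p k\<close> and moves it only
  when the current vertex leaves the ball of radius \<open>r\<close> around it.  Each move costs two factors (to
  the last vertex in the ball, and from there to the new anchor) and uses up length at least \<open>r\<close>.
  The summand \<open>1\<close> in the exponent pays for the step from the last anchor to the end point.
\<close>

lemma Harnack_chain:
  fixes p :: "nat \<Rightarrow> 'a::real_normed_vector" and f :: "'a \<Rightarrow> real"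
  assumes "0 < \<beta>" and "\<beta> \<le> 1" and "0 < r" and "0 \<le> f (p 0)"
    and step: "\<And>u v. u \<in> X \<Longrightarrow> v \<in> X \<Longrightarrow> norm (u - v) < r \<Longrightarrow> \<beta> * f u \<le> f v"
    and X: "\<And>i. i \<le> N \<Longrightarrow> p i \<in> X"
    and mesh: "\<And>i. i < N \<Longrightarrow> norm (p (Suc i) - p i) < r"
  shows "\<beta> powr (2 * (\<Sum>i<N. norm (p (Suc i) - p i)) / r + 1) * f (p 0) \<le> f (p N)"
proof -
  define S where "S = (\<lambda>m. \<Sum>i<m. norm (p (Suc i) - p i))"
  have dist_le: "norm (p k - p j) \<le> S j - S k" if "k \<le> j" for k j
    using that
  proof (induction j rule: dec_induct)
    case (step j)
    have "norm (p k - p (Suc j)) \<le> norm (p k - p j) + norm (p (Suc j) - p j)"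
      using norm_triangle_ineq4[of "p k - p j" "p (Suc j) - p j"] by simp
    with step.IH show ?case by (simp add: S_def)
  qed simp
  have anchor: "\<exists>k\<le>i. norm (p k - p i) < r \<and> \<beta> powr (2 * S k / r) * f (p 0) \<le> f (p k)"
    if "i \<le> N" for i
    using that
  proof (induction i)
    case 0
    then show ?case using assms(1,3) by (simp add: S_def)
  next
    case (Suc i)
    then obtain k where k: "k \<le> i" "norm (p k - p i) < r"
        "\<beta> powr (2 * S k / r) * f (p 0) \<le> f (p k)"
      by auto
    show ?case
    proof (cases "norm (p k - p (Suc i)) < r")
      case True
      with k show ?thesis by (intro exI[of _ k]) auto
    next
      case False
      have "r \<le> S (Suc i) - S k"
        using False dist_le[of k "Suc i"] k(1) by auto
      then have "2 * (S k + r) / r \<le> 2 * S (Suc i) / r"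
        using assms(3) by (intro divide_right_mono) auto
      then have "2 * S k / r + 2 \<le> 2 * S (Suc i) / r"
        using assms(3) by (simp add: add_divide_distrib)
      then have "\<beta> powr (2 * S (Suc i) / r) \<le> \<beta> powr (2 * S k / r + 2)"
        using assms(1,2) by (intro powr_mono') auto
      also have "\<dots> = \<beta> * (\<beta> * \<beta> powr (2 * S k / r))"
        using assms(1) by (simp add: powr_add power2_eq_square mult_ac)
      finally have "\<beta> powr (2 * S (Suc i) / r) * f (p 0)
          \<le> \<beta> * (\<beta> * (\<beta> powr (2 * S k / r) * f (p 0)))"
        using mult_right_mono[OF _ assms(4)] by (fastforce simp: mult.assoc)
      also have "\<dots> \<le> \<beta> * (\<beta> * f (p k))"
        using k(3) assms(1) by (intro mult_left_mono) auto
      also have "\<dots> \<le> \<beta> * f (p i)"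
        using k(1,2) Suc.prems assms(1) by (intro mult_left_mono step X) auto
      also have "\<dots> \<le> f (p (Suc i))"
        using Suc.prems mesh[of i] by (intro step X) (auto simp: norm_minus_commute)
      finally show ?thesis
        using assms(3) by (intro exI[of _ "Suc i"]) auto
    qed
  qed
  obtain k where k: "k \<le> N" "norm (p k - p N) < r"
      "\<beta> powr (2 * S k / r) * f (p 0) \<le> f (p k)"
    using anchor[of N] by auto
  have "S k \<le> S N"
    using dist_le[OF k(1)] norm_ge_zero[of "p k - p N"] by linarith
  then have "\<beta> powr (2 * S N / r + 1) \<le> \<beta> powr (2 * S k / r + 1)"
    using assms(1-3) by (intro powr_mono') (auto simp: divide_right_mono)
  also have "\<dots> = \<beta> * \<beta> powr (2 * S k / r)"
    using assms(1) by (simp add: powr_add)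
  finally have "\<beta> powr (2 * S N / r + 1) * f (p 0) \<le> \<beta> * (\<beta> powr (2 * S k / r) * f (p 0))"
    using mult_right_mono[OF _ assms(4)] by (fastforce simp: mult.assoc)
  also have "\<dots> \<le> \<beta> * f (p k)"
    using k(3) assms(1) by (intro mult_left_mono) auto
  also have "\<dots> \<le> f (p N)"
    using k(1,2) by (intro step X) auto
  finally show ?thesis by (simp add: S_def)
qed

lemma inscribed_polygon_le_curve_length:
  assumes "p 0 = 0" and "p N = 1" and "mono_on {..N} p"
  shows "ennreal (\<Sum>i<N. norm (g (p (Suc i)) - g (p i))) \<le> curve_length g"
  unfolding curve_length_def
  by (rule SUP_upper2[of "(N, p)"]) (use assms in auto)

text \<open>
  By uniform continuity, equidistant parameters give an inscribed polygon with sides shorter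
  than \<open>r\<close>.
\<close>

lemma Harnack_curve:
  fixes g :: "real \<Rightarrow> 'a::real_normed_vector" and f :: "'a \<Rightarrow> real"
  assumes "0 < \<beta>" and "\<beta> \<le> 1" and "0 < r" and "0 \<le> f (pathstart g)"
    and step: "\<And>u v. u \<in> X \<Longrightarrow> v \<in> X \<Longrightarrow> norm (u - v) < r \<Longrightarrow> \<beta> * f u \<le> f v"
    and "path g" and "path_image g \<subseteq> X"
    and len: "curve_length g \<le> ennreal l" and "0 \<le> l"
  shows "\<beta> powr (2 * l / r + 1) * f (pathstart g) \<le> f (pathfinish g)"
proof -
  have "uniformly_continuous_on {0..1} g"
    using assms(6) unfolding path_def by (intro compact_uniformly_continuous) auto
  then obtain d where d: "0 < d"
      "\<And>s t. s \<in> {0..1} \<Longrightarrow> t \<in> {0..1} \<Longrightarrow> dist t s < d \<Longrightarrow> dist (g t) (g s) < r"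
    using assms(3) unfolding uniformly_continuous_on_def by metis
  obtain N where N: "N \<noteq> 0" "inverse (real N) < d"
    using d(1) real_arch_inverse by blast
  define p where "p = (\<lambda>i. real i / real N)"
  have p01: "p i \<in> {0..1}" if "i \<le> N" for i
    using that N(1) by (simp add: p_def)
  have p_ends: "p 0 = 0" "p N = 1"
    using N(1) by (simp_all add: p_def)
  have p_mono: "mono_on {..N} p"
    by (auto intro!: mono_onI divide_right_mono simp: p_def)
  have mesh: "norm (g (p (Suc i)) - g (p i)) < r" if "i < N" for i
  proof -
    have "dist (p (Suc i)) (p i) = inverse (real N)"
      using N(1) by (simp add: p_def dist_real_def field_simps)
    then show ?thesis
      using d(2)[of "p i" "p (Suc i)"] p01 that N(2) by (simp add: dist_norm)
  qed
  have "ennreal (\<Sum>i<N. norm (g (p (Suc i)) - g (p i))) \<le> ennreal l"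
    using inscribed_polygon_le_curve_length[OF p_ends p_mono] len by (rule order_trans)
  then have "(\<Sum>i<N. norm (g (p (Suc i)) - g (p i))) \<le> l"
    using assms(9) by (simp add: ennreal_le_iff)
  then have "\<beta> powr (2 * l / r + 1)
      \<le> \<beta> powr (2 * (\<Sum>i<N. norm (g (p (Suc i)) - g (p i))) / r + 1)"
    using assms(1-3) by (intro powr_mono') (auto simp: divide_right_mono)
  then have "\<beta> powr (2 * l / r + 1) * f (pathstart g)
      \<le> \<beta> powr (2 * (\<Sum>i<N. norm (g (p (Suc i)) - g (p i))) / r + 1) * f (pathstart g)"
    using assms(4) by (rule mult_right_mono)
  also have "\<dots> \<le> f (pathfinish g)"
  proof -
    have "g (p i) \<in> X" if "i \<le> N" for i
      using p01[OF that] assms(7) unfolding path_image_def by blast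
    then show ?thesis
      using Harnack_chain[of \<beta> r f "\<lambda>i. g (p i)" X N] assms(1-4) step mesh
      by (simp add: p_ends pathstart_def pathfinish_def)
  qed
  finally show ?thesis .
qed

section \<open>The two regimes\<close>

text \<open>
  The radius is chosen so that the ball of radius \<open>r\<close> has measure exactly \<open>1 / t\<close>, which makes \<open>t\<close>
  the right end point of the range of levels allowed in \<^const>\<open>A1\<close>.
\<close>

lemma A1_step:
  fixes \<Omega> :: "'a::euclidean_space set" and t :: real
  defines "r \<equiv> inverse ((unit_ball_vol DIM('a) * t) powr (1 / real DIM('a)))"
  assumes "\<forall>z r. 0 < r \<and> measure lebesgue (ball z r) \<le> 1 \<longrightarrow>
     (\<forall>x\<in>ball z r \<inter> \<Omega>. \<forall>y\<in>ball z r \<inter> \<Omega>. \<forall>t\<in>{1..1 / measure lebesgue (ball z r)}.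
        \<beta> * left_inverse \<phi> x t \<le> left_inverse \<phi> y t)"
    and "1 \<le> t" and "x \<in> \<Omega>" and "y \<in> \<Omega>" and "norm (x - y) < r"
  shows "\<beta> * left_inverse \<phi> x t \<le> left_inverse \<phi> y t"
proof -
  have V: "0 < unit_ball_vol DIM('a) * t"
    using assms(3) by (auto intro!: mult_pos_pos)
  then have r: "0 < r" by (auto simp: r_def)
  have "((unit_ball_vol DIM('a) * t) powr (1 / real DIM('a))) ^ DIM('a)
      = unit_ball_vol DIM('a) * t"
    using V by (subst powr_realpow[symmetric]) (auto simp: powr_powr)
  then have "measure lebesgue (ball x r) = 1 / t"
    using r V by (simp add: content_ball r_def power_inverse field_simps measure_completion)
  moreover have "y \<in> ball x r"
    using assms(6) by (simp add: dist_norm)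
  ultimately show ?thesis
    using assms(2)[rule_format, of r x x y t] assms(3-5) r by simp
qed

text \<open>
  With \<open>u\<close> the \<open>n\<close>-th root of \<open>t\<close>, one has \<open>t \<le> exp (n * u)\<close>; so \<open>exp (- b * d * u)\<close> absorbs \<open>t\<close> as
  soon as \<open>b \<ge> n / d\<close>, and the remaining factor \<open>exp (- b)\<close> can be made smaller than \<open>c\<close>.
\<close>

lemma exp_decay_beats_power:
  fixes c d n :: real
  assumes "0 < c" and "0 < d" and "0 < n"
  shows "\<exists>\<beta>\<in>{0<..<1}. \<forall>t\<ge>1. \<beta> powr (d * t powr (1 / n) + 1) * t \<le> c"
proof -
  define b where "b = max (n / d) (- ln c)"
  have "n / d \<le> b" "- b \<le> ln c" and "0 < n / d"
    using assms by (auto simp: b_def)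
  then have b: "0 < b" "n \<le> b * d" "- b \<le> ln c"
    using assms(2) by (linarith, simp_all add: pos_divide_le_eq)
  have "exp (- b) powr (d * t powr (1 / n) + 1) * t \<le> c" if "1 \<le> t" for t
  proof -
    define u where "u = t powr (1 / n)"
    have u: "0 < u" and t: "t = exp (n * ln u)"
      using that assms(3) by (auto simp: u_def ln_powr)
    have "n * ln u \<le> n * u"
      using assms(3) ln_le_minus_one[OF u] by (intro mult_left_mono) auto
    also have "\<dots> \<le> b * d * u"
      using b(2) u by (intro mult_right_mono) auto
    finally have "- b * (d * u + 1) + n * ln u \<le> ln c"
      using b(3) by (simp add: algebra_simps)
    then have "exp (- b * (d * u + 1) + n * ln u) \<le> exp (ln c)"
      by simp
    then have "exp (- b * (d * u + 1)) * t \<le> c"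
      by (simp only: exp_add exp_ln[OF assms(1)] flip: t)
    moreover have "exp (- b) powr (d * u + 1) = exp (- b * (d * u + 1))"
      by (simp add: powr_def mult.commute)
    ultimately show ?thesis by (simp add: u_def)
  qed
  then show ?thesis
    using b(1) by (intro bexI[of _ "exp (- b)"]) auto
qed

lemma A1_imp_A1_Omega_near:
  fixes \<Omega> :: "'a::euclidean_space set"
  assumes "1 \<le> K" and qc: "quasi_convex K \<delta> \<Omega>" and "A1 \<Omega> \<phi>"
    and nonneg: "\<And>x t. x \<in> \<Omega> \<Longrightarrow> 1 \<le> t \<Longrightarrow> 0 \<le> left_inverse \<phi> x t"
  shows "\<exists>\<beta>\<in>{0<..<1}. \<forall>x\<in>\<Omega>. \<forall>y\<in>\<Omega>. \<forall>t\<ge>1. norm (x - y) < \<delta> \<longrightarrow>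
     \<beta> powr (norm (x - y) * t powr (1 / real DIM('a)) + 1) * left_inverse \<phi> x t
       \<le> left_inverse \<phi> y t"
proof -
  obtain \<beta> where \<beta>: "0 < \<beta>" "\<beta> < 1" and
    A1: "\<forall>z r. 0 < r \<and> measure lebesgue (ball z r) \<le> 1 \<longrightarrow>
     (\<forall>x\<in>ball z r \<inter> \<Omega>. \<forall>y\<in>ball z r \<inter> \<Omega>. \<forall>t\<in>{1..1 / measure lebesgue (ball z r)}.
        \<beta> * left_inverse \<phi> x t \<le> left_inverse \<phi> y t)"
    using assms(3) unfolding A1_def by auto
  define V where "V = unit_ball_vol (real DIM('a)) powr (1 / real DIM('a))"
  \<comment> \<open>\<open>2 * K * V\<close> is the number of factors per unit of \<open>|x - y|\<close> when \<open>t = 1\<close>; the maximum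
     with \<open>1\<close> also pays for the one factor that is always needed.\<close>
  define M where "M = max 1 (2 * K * V)"
  have M: "1 \<le> M" "2 * K * V \<le> M" by (simp_all add: M_def)
  have "(\<beta> powr M) powr (norm (x - y) * t powr (1 / real DIM('a)) + 1) * left_inverse \<phi> x t
       \<le> left_inverse \<phi> y t"
    if x: "x \<in> \<Omega>" and y: "y \<in> \<Omega>" and t: "1 \<le> t" and near: "norm (x - y) < \<delta>" for x y t
  proof -
    define T where "T = t powr (1 / real DIM('a))"
    define r where "r = inverse ((unit_ball_vol DIM('a) * t) powr (1 / real DIM('a)))"
    have rT: "r = inverse (V * T)"
      using t by (simp add: r_def V_def T_def powr_mult)
    have "0 < unit_ball_vol (real DIM('a)) * t"
      using t by (intro mult_pos_pos) auto
    then have r: "0 < r" by (auto simp: r_def)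
    have T: "0 \<le> T" by (simp add: T_def)
    obtain g where g: "rectifiable g" "path_image g \<subseteq> \<Omega>" "pathstart g = x" "pathfinish g = y"
        "curve_length g \<le> ennreal (K * norm (x - y))"
      using qc x y near unfolding quasi_convex_def by blast
    have "2 * (K * norm (x - y)) / r + 1 = 2 * K * V * (norm (x - y) * T) + 1"
      by (simp add: rT field_simps)
    also have "\<dots> \<le> M * (norm (x - y) * T) + M"
      using M T by (intro add_mono mult_right_mono) auto
    finally have "\<beta> powr (M * (norm (x - y) * T + 1))
        \<le> \<beta> powr (2 * (K * norm (x - y)) / r + 1)"
      using \<beta> by (intro powr_mono') (auto simp: algebra_simps)
    then have "\<beta> powr (M * (norm (x - y) * T + 1)) * left_inverse \<phi> x t
        \<le> \<beta> powr (2 * (K * norm (x - y)) / r + 1) * left_inverse \<phi> x t"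
      using nonneg[OF x t] by (rule mult_right_mono)
    also have "\<dots> \<le> left_inverse \<phi> y t"
      using Harnack_curve[of \<beta> r "\<lambda>u. left_inverse \<phi> u t" g \<Omega> "K * norm (x - y)"]
        A1_step[OF A1 t, folded r_def] \<beta> r g nonneg[OF x t] assms(1)
      by (simp add: rectifiable_def)
    finally show ?thesis by (simp add: powr_powr T_def)
  qed
  moreover have "\<beta> powr M \<in> {0<..<1}"
    using \<beta> M(1) powr_less_mono'[of \<beta> 0 M] by auto
  ultimately show ?thesis by (intro bexI[of _ "\<beta> powr M"]) auto
qed

lemma A0_imp_A1_Omega_far:
  fixes \<Omega> :: "'a::euclidean_space set"
  assumes "0 < \<delta>" and Phi: "weak_Phi \<Omega> \<phi>" and "0 < b"
    and lower: "\<And>x t. x \<in> \<Omega> \<Longrightarrow> 1 \<le> t \<Longrightarrow> b \<le> left_inverse \<phi> x t"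
    and upper: "\<And>x. x \<in> \<Omega> \<Longrightarrow> left_inverse \<phi> x 1 \<le> inverse b"
  shows "\<exists>\<beta>\<in>{0<..<1}. \<forall>x\<in>\<Omega>. \<forall>y\<in>\<Omega>. \<forall>t\<ge>1. \<delta> \<le> norm (x - y) \<longrightarrow>
     \<beta> powr (norm (x - y) * t powr (1 / real DIM('a)) + 1) * left_inverse \<phi> x t
       \<le> left_inverse \<phi> y t"
proof -
  obtain L where L: "1 \<le> L"
    and inc: "\<And>x. x \<in> \<Omega> \<Longrightarrow> almost_increasing_on {0<..} L (\<lambda>t. \<phi> x t / ennreal t)"
    using Phi unfolding weak_Phi_def by blast
  have "0 < b * b / (2 * L)" using assms(3) L by simp
  then obtain \<beta> where \<beta>: "0 < \<beta>" "\<beta> < 1" and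
    decay: "\<And>t. 1 \<le> t \<Longrightarrow> \<beta> powr (\<delta> * t powr (1 / real DIM('a)) + 1) * t \<le> b * b / (2 * L)"
    using exp_decay_beats_power[of "b * b / (2 * L)" \<delta> "real DIM('a)"] assms(1) by auto
  have "\<beta> powr (norm (x - y) * t powr (1 / real DIM('a)) + 1) * left_inverse \<phi> x t
       \<le> left_inverse \<phi> y t"
    if x: "x \<in> \<Omega>" and y: "y \<in> \<Omega>" and t: "1 \<le> t" and far: "\<delta> \<le> norm (x - y)" for x y t
  proof -
    have "0 \<le> left_inverse \<phi> x t"
      using lower[OF x t] assms(3) by linarith
    then have "\<beta> powr (norm (x - y) * t powr (1 / real DIM('a)) + 1) * left_inverse \<phi> x t
        \<le> \<beta> powr (\<delta> * t powr (1 / real DIM('a)) + 1) * (2 * L / b * t)"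
      using far \<beta> left_inverse_le_linear[OF Phi x inc[OF x] L assms(3) upper[OF x] t]
      by (intro mult_mono powr_mono' add_mono mult_right_mono) auto
    also have "\<dots> = 2 * L / b * (\<beta> powr (\<delta> * t powr (1 / real DIM('a)) + 1) * t)"
      by (simp add: mult_ac)
    also have "\<dots> \<le> 2 * L / b * (b * b / (2 * L))"
      using L assms(3) by (intro mult_left_mono decay t) auto
    also have "\<dots> = b"
      using L assms(3) by simp
    also have "\<dots> \<le> left_inverse \<phi> y t"
      by (rule lower[OF y t])
    finally show ?thesis .
  qed
  then show ?thesis using \<beta> by (intro bexI[of _ \<beta>]) auto
qed

theorem lemma3p6:
  fixes \<Omega> :: "(real ^ 'n) set" and \<phi> :: "real ^ 'n \<Rightarrow> real \<Rightarrow> ennreal"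
    and K \<delta> q :: real
  assumes "open \<Omega>"
    and "1 \<le> K" and "0 < \<delta>" and "quasi_convex K \<delta> \<Omega>"
    and "weak_Phi \<Omega> \<phi>"
    and "A0 \<Omega> \<phi>"
    and "1 \<le> q" and "aDec \<Omega> q \<phi>"
    and "A1 \<Omega> \<phi>"
  shows "A1_Omega \<Omega> \<phi>"
proof -
  obtain b where b: "0 < b"
    and at_one: "\<And>x. x \<in> \<Omega> \<Longrightarrow> b \<le> left_inverse \<phi> x 1"
      "\<And>x. x \<in> \<Omega> \<Longrightarrow> left_inverse \<phi> x 1 \<le> inverse b"
    using assms(6) unfolding A0_def by auto
  have lower: "b \<le> left_inverse \<phi> x t" if "x \<in> \<Omega>" "1 \<le> t" for x t
    using at_one(1)[OF that(1)] weak_Phi_level_reached[OF assms(5) that(1), of t]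
      left_inverse_mono[OF that(2)] by (meson order_trans)
  have nonneg: "0 \<le> left_inverse \<phi> x t" if "x \<in> \<Omega>" "1 \<le> t" for x t
    using lower[OF that] b by linarith
  let ?e = "\<lambda>x y t. norm (x - y) * t powr (1 / real DIM(real ^ 'n)) + 1"
  obtain \<beta>1 where \<beta>1: "0 < \<beta>1" "\<beta>1 < 1" and
    near: "\<And>x y t. x \<in> \<Omega> \<Longrightarrow> y \<in> \<Omega> \<Longrightarrow> 1 \<le> t \<Longrightarrow> norm (x - y) < \<delta> \<Longrightarrow>
      \<beta>1 powr ?e x y t * left_inverse \<phi> x t \<le> left_inverse \<phi> y t"
    using A1_imp_A1_Omega_near[OF assms(2,4,9) nonneg] by auto
  obtain \<beta>2 where \<beta>2: "0 < \<beta>2" "\<beta>2 < 1" and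
    far: "\<And>x y t. x \<in> \<Omega> \<Longrightarrow> y \<in> \<Omega> \<Longrightarrow> 1 \<le> t \<Longrightarrow> \<delta> \<le> norm (x - y) \<Longrightarrow>
      \<beta>2 powr ?e x y t * left_inverse \<phi> x t \<le> left_inverse \<phi> y t"
    using A0_imp_A1_Omega_far[OF assms(3,5) b lower at_one(2)] by auto
  have "min \<beta>1 \<beta>2 powr ?e x y t * left_inverse \<phi> x t \<le> left_inverse \<phi> y t"
    if xyt: "x \<in> \<Omega>" "y \<in> \<Omega>" "1 \<le> t" for x y t
  proof -
    have smaller: "min \<beta>1 \<beta>2 powr ?e x y t * left_inverse \<phi> x t
        \<le> c powr ?e x y t * left_inverse \<phi> x t" if "min \<beta>1 \<beta>2 \<le> c" for c
      using that \<beta>1 \<beta>2 nonneg[OF xyt(1,3)] by (intro mult_right_mono powr_mono2) auto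
    show ?thesis
    proof (cases "norm (x - y) < \<delta>")
      case True
      then show ?thesis using smaller[of \<beta>1] near[OF xyt] by simp
    next
      case False
      then show ?thesis using smaller[of \<beta>2] far[OF xyt] by simp
    qed
  qed
  then show ?thesis
    unfolding A1_Omega_def using \<beta>1 \<beta>2 by (intro bexI[of _ "min \<beta>1 \<beta>2"]) auto
qed

end
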